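(* Let $B\ge1$ be an integer and let $W^1,\dots,W^B$ be i.i.d. exchangeable resampling weight vectors such that $W_1^1-\overline{W^1}\in[c_1,c_2]$ almost surely. Let $p\in[1,\infty]$ and let $\phi:\mathbb{R}^K\to\mathbb{R}$ be any subadditive function bounded by the $\ell_p$-norm. If $\mathbf{Y}=(\mathbf{Y}^1,\dots,\mathbf{Y}^n)\in(\mathbb{R}^K)^n$ is a fixed (deterministic) sample, then, for every $\beta\in(0,1)$, $$\mathbb{E}_W[\phi(\overline{\mathbf{Y}}^{\langle W-\overline{W}\rangle})]\le\frac1B\sum_{j=1}^B\phi\big(\overline{\mathbf{Y}}^{\langle W^j-\overline{W^j}\rangle}\big)+(c_2-c_1)\sqrt{\frac{\log(\beta^{-1})}{2B}}\;\|\widetilde{\sigma}\|_p$$ holds with probability at least $1-\beta$, where $\widetilde{\sigma}:=\big(\frac1n\sum_{i=1}^n|\mathbf{Y}^i_k-M_k|\big)_{1\le k\le K}$ is the vector of average absolute deviations to the median, $M_k$ denoting a median of $(\mathbf{Y}^i_k)_{1\le i\le n}$.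
   Context: $K\ge1$ and $n\ge2$ are integers. For $w\in\mathbb{R}^n$, $\overline{w}=\frac1n\sum_{i=1}^nw_i$, $w-\overline{w}=(w_i-\overline{w})_{1\le i\le n}$ and $\overline{\mathbf{Y}}^{\langle w\rangle}=\frac1n\sum_{i=1}^nw_i\mathbf{Y}^i$. A resampling weight vector is an $\mathbb{R}^n$-valued random vector $W$ (independent of the data) with $\mathbb{E}[W_i^2]<\infty$ for all $i$ and $n^{-1}\sum_{i=1}^n\mathbb{E}|W_i-\overline{W}|>0$; it is exchangeable if its distribution is invariant under permutations of the indices. On the left-hand side $W$ denotes a vector with the common distribution of the $W^j$, and $\mathbb{E}_W$ is expectation over $W$. Subadditive means $\phi(x+x')\le\phi(x)+\phi(x')$; bounded by the $\ell_p$-norm means $|\phi(x)|\le\|x\|_p$ for all $x$, with $\|\cdot\|_p$ the $\ell_p$-norm (max-norm for $p=\infty$). *)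

theory Defs
  imports "HOL-Probability.Probability"
begin

text \<open>Vectors in \<open>\<real>\<^sup>n\<close> are elements of \<open>real ^ 'n\<close> with \<open>n = CARD('n)\<close>; a sample
  \<open>Y\<close> of \<open>n\<close> points of \<open>\<real>\<^sup>K\<close> is an element of \<open>real ^ 'k ^ 'n\<close>, so that
  \<open>Y $ i $ k\<close> is the \<open>k\<close>-th coordinate of the \<open>i\<close>-th point.\<close>

definition vec_mean :: "real ^ 'n \<Rightarrow> real" where
  "vec_mean w = (\<Sum>i\<in>UNIV. w $ i) / real CARD('n)"

definition centered :: "real ^ 'n \<Rightarrow> real ^ 'n" where
  "centered w = (\<chi> i. w $ i - vec_mean w)"

definition weighted_mean :: "real ^ 'k ^ 'n \<Rightarrow> real ^ 'n \<Rightarrow> real ^ 'k" where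
  "weighted_mean Y w = (1 / real CARD('n)) *\<^sub>R (\<Sum>i\<in>UNIV. w $ i *\<^sub>R Y $ i)"

definition lp_norm :: "ennreal \<Rightarrow> real ^ 'k \<Rightarrow> real" where
  "lp_norm p x =
     (if p = \<infinity> then Max (range (\<lambda>k. \<bar>x $ k\<bar>))
      else (\<Sum>k\<in>UNIV. \<bar>x $ k\<bar> powr enn2real p) powr (1 / enn2real p))"

definition resampling_weight :: "'a measure \<Rightarrow> ('a \<Rightarrow> real ^ 'n) \<Rightarrow> bool" where
  "resampling_weight M W \<longleftrightarrow>
     W \<in> borel_measurable M \<and>
     (\<forall>i. integrable M (\<lambda>\<omega>. (W \<omega> $ i)\<^sup>2)) \<and>
     (\<Sum>i\<in>UNIV. (\<integral>\<omega>. \<bar>W \<omega> $ i - vec_mean (W \<omega>)\<bar> \<partial>M)) / real CARD('n) > 0"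

definition exchangeable :: "'a measure \<Rightarrow> ('a \<Rightarrow> real ^ 'n) \<Rightarrow> bool" where
  "exchangeable M W \<longleftrightarrow>
     (\<forall>\<pi>. \<pi> permutes UNIV \<longrightarrow>
        distr M borel (\<lambda>\<omega>. \<chi> i. W \<omega> $ \<pi> i) = distr M borel W)"

text \<open>A median need not be unique; \<open>is_median y m\<close> holds for every median \<open>m\<close> of the
  finite family \<open>y\<close>: at least half of the values are \<open>\<le> m\<close> and at least half are \<open>\<ge> m\<close>.\<close>

definition is_median :: "('n::finite \<Rightarrow> real) \<Rightarrow> real \<Rightarrow> bool" where
  "is_median y m \<longleftrightarrow>
     real (card {i. y i \<le> m}) \<ge> real CARD('n) / 2 \<and>
     real (card {i. y i \<ge> m}) \<ge> real CARD('n) / 2"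

definition abs_deviation :: "real ^ 'k ^ 'n \<Rightarrow> real ^ 'k \<Rightarrow> real ^ 'k" where
  "abs_deviation Y m = (\<chi> k. (\<Sum>i\<in>UNIV. \<bar>Y $ i $ k - m $ k\<bar>) / real CARD('n))"

end

theory Submission
  imports Defs
begin

text \<open>
  Put \<open>f w = \<phi> (weighted_mean Y (centered w))\<close>. The statement is a one-sided Hoeffding bound for
  the independent, identically distributed variables \<open>f (W j)\<close>, whose common expectation is the
  left-hand side; all the work lies in showing that they almost surely take their values in an
  interval of length \<open>L = (c\<^sub>2 - c\<^sub>1) * lp_norm p (abs_deviation Y m)\<close>.

  By exchangeability every centered weight, not only the one of index \<open>i\<^sub>1\<close>, almost surely lies in
  \<open>{c\<^sub>1..c\<^sub>2}\<close> (\<open>exchangeable_AE_centered\<close>). Let \<open>d\<close> and \<open>e\<close> be two vectors of centered weights with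
  this property. Both have coordinate sum \<open>0\<close>, so that the difference of their weighted means does not
  change when the points \<open>Y $ i\<close> are replaced by \<open>Y $ i - m\<close>; as \<open>\<bar>d $ i - e $ i\<bar> \<le> c\<^sub>2 - c\<^sub>1\<close>, each
  coordinate of the difference is at most \<open>(c\<^sub>2 - c\<^sub>1) * abs_deviation Y m $ k\<close> in absolute value
  (\<open>weighted_mean_diff_le\<close>). A subadditive function dominated by the \<open>\<ell>\<^sub>p\<close>-norm satisfies
  \<open>\<phi> x - \<phi> y \<le> \<phi> (x - y) \<le> lp_norm p (x - y)\<close>, and monotonicity and homogeneity of the norm
  turn the coordinatewise bound into \<open>f v - f w \<le> L\<close> (\<open>functional_oscillation\<close>). A set of reals
  with oscillation \<open>L\<close> fits into an interval of length \<open>L\<close>, and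
  \<open>Hoeffding_mean_confidence\<close> concludes.
\<close>

section \<open>Subadditive functions dominated by an \<open>\<ell>\<^sub>p\<close>-norm\<close>

lemma lp_norm_mono:
  assumes "\<And>k. \<bar>x $ k\<bar> \<le> \<bar>y $ k\<bar>"
  shows "lp_norm p x \<le> lp_norm p y"
proof (cases "p = \<infinity>")
  case True
  have "\<bar>x $ k\<bar> \<le> Max (range (\<lambda>k. \<bar>y $ k\<bar>))" for k
    by (rule order_trans[OF assms[of k]]) (rule Max_ge, auto)
  with True show ?thesis
    by (auto simp: lp_norm_def intro!: Max.boundedI)
next
  case False
  then show ?thesis
    using assms by (auto simp: lp_norm_def intro!: powr_mono2 sum_mono sum_nonneg)
qed

lemma lp_norm_nonneg: "0 \<le> lp_norm p x"
proof (cases "p = \<infinity>")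
  case True
  have "0 \<le> \<bar>x $ undefined\<bar>" by simp
  also have "\<dots> \<le> Max (range (\<lambda>k. \<bar>x $ k\<bar>))" by (rule Max_ge) auto
  finally show ?thesis using True by (simp add: lp_norm_def)
qed (simp add: lp_norm_def)

lemma lp_norm_scaleR:
  assumes "1 \<le> p" and "0 \<le> c"
  shows "lp_norm p (c *\<^sub>R x) = c * lp_norm p x"
proof (cases "p = \<infinity>")
  case True
  have "mono (\<lambda>t. c * t)" using \<open>0 \<le> c\<close> by (simp add: mono_def mult_left_mono)
  from mono_Max_commute[OF this, of "range (\<lambda>k. \<bar>x $ k\<bar>)"] True \<open>0 \<le> c\<close>
  show ?thesis by (simp add: lp_norm_def abs_mult image_image)
next
  case False
  have "enn2real 1 \<le> enn2real p"
    using False \<open>1 \<le> p\<close> by (intro enn2real_mono) (auto simp: top.not_eq_extremum)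
  then have "enn2real p \<ge> 1" by simp
  with False \<open>0 \<le> c\<close> show ?thesis
    by (simp add: lp_norm_def abs_mult powr_mult powr_powr sum_nonneg flip: sum_distrib_left)
qed

text \<open>
  Each coordinate of \<open>x\<close> is at most \<open>norm x\<close> in absolute value, hence \<open>x\<close> is dominated
  coordinatewise by \<open>norm x *\<^sub>R 1\<close>, where \<open>1\<close> is the vector with all coordinates equal to one.
\<close>

lemma lp_norm_le_norm:
  fixes x :: "real ^ 'k"
  assumes "1 \<le> p"
  shows "lp_norm p x \<le> lp_norm p (1 :: real ^ 'k) * norm x"
proof -
  have "lp_norm p x \<le> lp_norm p (norm x *\<^sub>R (1 :: real ^ 'k))"
    by (rule lp_norm_mono) (simp add: component_le_norm_cart)
  then show ?thesis
    using assms by (simp add: lp_norm_scaleR mult.commute)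
qed

text \<open>Write \<open>x = (x - y) + y\<close> and use subadditivity.\<close>

lemma subadditive_diff_le:
  fixes \<phi> :: "real ^ 'k \<Rightarrow> real"
  assumes "\<And>x x'. \<phi> (x + x') \<le> \<phi> x + \<phi> x'" and "\<And>x. \<bar>\<phi> x\<bar> \<le> lp_norm p x"
  shows "\<phi> x - \<phi> y \<le> lp_norm p (x - y)"
  using assms(1)[of "x - y" y] assms(2)[of "x - y"] by simp

text \<open>
  The previous bound in both directions makes \<open>\<phi>\<close> Lipschitz for the Euclidean distance. This is
  what makes \<open>\<phi>\<close> of the resampled mean a random variable.
\<close>

lemma subadditive_continuous:
  fixes \<phi> :: "real ^ 'k \<Rightarrow> real"
  assumes "1 \<le> p"
    and "\<And>x x'. \<phi> (x + x') \<le> \<phi> x + \<phi> x'" and "\<And>x. \<bar>\<phi> x\<bar> \<le> lp_norm p x"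
  shows "continuous_on UNIV \<phi>"
proof -
  let ?C = "lp_norm p (1 :: real ^ 'k)"
  have le: "\<phi> x - \<phi> y \<le> ?C * norm (x - y)" for x y
    using subadditive_diff_le[OF assms(2,3), of x y] lp_norm_le_norm[OF assms(1), of "x - y"]
    by linarith
  have "dist (\<phi> x) (\<phi> y) \<le> ?C * dist x y" for x y
    using le[of x y] le[of y x] by (simp add: dist_norm norm_minus_commute abs_le_iff)
  then have "?C-lipschitz_on UNIV \<phi>"
    by (intro lipschitz_onI) (auto simp: lp_norm_nonneg)
  then show ?thesis by (rule lipschitz_on_continuous_on)
qed

section \<open>Oscillation of the resampled functional\<close>

lemma sum_centered: "(\<Sum>i\<in>UNIV. centered w $ i) = 0"
  by (simp add: centered_def vec_mean_def sum_subtractf)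

text \<open>
  The differences \<open>d $ i - e $ i\<close> sum to zero, so a constant \<open>m $ k\<close> may be subtracted from all the
  values \<open>Y $ i $ k\<close> before the triangle inequality is applied.
\<close>

lemma weighted_mean_diff_le:
  fixes Y :: "real ^ 'k ^ 'n"
  assumes "(\<Sum>i\<in>UNIV. d $ i) = (\<Sum>i\<in>UNIV. e $ i)" and "\<And>i. \<bar>d $ i - e $ i\<bar> \<le> c"
  shows "\<bar>(weighted_mean Y d - weighted_mean Y e) $ k\<bar> \<le> c * abs_deviation Y m $ k"
proof -
  have "(\<Sum>i\<in>UNIV. (d $ i - e $ i) * Y $ i $ k)
      = (\<Sum>i\<in>UNIV. (d $ i - e $ i) * (Y $ i $ k - m $ k))"
    using assms(1) by (simp add: algebra_simps sum_subtractf sum.distrib flip: sum_distrib_left)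
  moreover have "\<bar>\<Sum>i\<in>UNIV. (d $ i - e $ i) * (Y $ i $ k - m $ k)\<bar>
      \<le> (\<Sum>i\<in>UNIV. c * \<bar>Y $ i $ k - m $ k\<bar>)"
    by (rule order_trans[OF sum_abs]) (auto intro!: sum_mono mult_right_mono assms(2) simp: abs_mult)
  moreover have "(weighted_mean Y d - weighted_mean Y e) $ k
      = (\<Sum>i\<in>UNIV. (d $ i - e $ i) * Y $ i $ k) / real CARD('n)"
    by (simp add: weighted_mean_def left_diff_distrib sum_subtractf diff_divide_distrib)
  ultimately show ?thesis
    by (simp add: abs_deviation_def divide_right_mono flip: sum_distrib_left)
qed

text \<open>
  The coordinatewise bound above passes to \<open>\<phi>\<close> because the \<open>\<ell>\<^sub>p\<close>-norm is monotone in the absolute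
  values of the coordinates and \<open>\<phi>\<close> is \<open>1\<close>-Lipschitz for it.
\<close>

lemma functional_oscillation:
  fixes Y :: "real ^ 'k ^ 'n" and \<phi> :: "real ^ 'k \<Rightarrow> real"
  assumes "1 \<le> p"
    and "\<And>x x'. \<phi> (x + x') \<le> \<phi> x + \<phi> x'" and "\<And>x. \<bar>\<phi> x\<bar> \<le> lp_norm p x"
    and "\<And>i. centered v $ i \<in> {c\<^sub>1..c\<^sub>2}" and "\<And>i. centered w $ i \<in> {c\<^sub>1..c\<^sub>2}"
  shows "\<phi> (weighted_mean Y (centered v)) - \<phi> (weighted_mean Y (centered w))
           \<le> (c\<^sub>2 - c\<^sub>1) * lp_norm p (abs_deviation Y m)"
proof -
  let ?v = "weighted_mean Y (centered v)" and ?w = "weighted_mean Y (centered w)"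
  have "c\<^sub>1 \<le> c\<^sub>2" using assms(4)[of undefined] by simp
  have "\<bar>centered v $ i - centered w $ i\<bar> \<le> c\<^sub>2 - c\<^sub>1" for i
    using assms(4,5)[of i] by auto
  then have "\<bar>(?v - ?w) $ k\<bar> \<le> (c\<^sub>2 - c\<^sub>1) * abs_deviation Y m $ k" for k
    by (rule weighted_mean_diff_le[rotated]) (simp add: sum_centered)
  then have "lp_norm p (?v - ?w) \<le> lp_norm p ((c\<^sub>2 - c\<^sub>1) *\<^sub>R abs_deviation Y m)"
    by (intro lp_norm_mono) (simp add: order_trans[OF _ abs_ge_self])
  then show ?thesis
    using subadditive_diff_le[OF assms(2,3), of ?v ?w] \<open>1 \<le> p\<close> \<open>c\<^sub>1 \<le> c\<^sub>2\<close>
    by (simp add: lp_norm_scaleR)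
qed

section \<open>Exchangeable weights\<close>

lemma measurable_vec_mean [measurable]: "vec_mean \<in> borel_measurable borel"
  unfolding vec_mean_def by measurable

lemma measurable_centered_nth [measurable]: "(\<lambda>w. centered w $ i) \<in> borel_measurable borel"
  unfolding centered_def by simp

lemma continuous_weighted_mean_centered:
  "continuous_on UNIV (\<lambda>w. weighted_mean Y (centered w))"
  unfolding weighted_mean_def centered_def vec_mean_def
  by (simp, intro continuous_intros) auto

text \<open>
  The transposition of \<open>i\<^sub>1\<close> and \<open>i\<close> preserves the law of \<open>W\<close> and the mean of its coordinates, and it
  carries the centered weight of index \<open>i\<^sub>1\<close> to that of index \<open>i\<close>.
\<close>

lemma exchangeable_AE_centered:
  fixes W :: "'a \<Rightarrow> real ^ 'n"
  assumes [measurable]: "W \<in> borel_measurable M"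
    and "exchangeable M W" and "AE \<omega> in M. centered (W \<omega>) $ i\<^sub>1 \<in> {c\<^sub>1..c\<^sub>2}"
  shows "AE \<omega> in M. \<forall>i. centered (W \<omega>) $ i \<in> {c\<^sub>1..c\<^sub>2}"
proof -
  have "AE \<omega> in M. centered (W \<omega>) $ i \<in> {c\<^sub>1..c\<^sub>2}" for i
  proof -
    let ?\<pi> = "Transposition.transpose i\<^sub>1 i"
    have perm: "?\<pi> permutes UNIV" by (rule permutes_swap_id) auto
    have [measurable]: "(\<lambda>\<omega>. \<chi> i. W \<omega> $ ?\<pi> i) \<in> borel_measurable M"
      by (rule measurable_compose[OF assms(1)])
        (intro borel_measurable_continuous_onI continuous_intros)
    have "vec_mean (\<chi> i. w $ ?\<pi> i) = vec_mean w" for w :: "real ^ 'n"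
      using sum.permute[OF perm, of "\<lambda>i. w $ i"] by (simp add: vec_mean_def comp_def)
    then have swap: "centered (\<chi> i. w $ ?\<pi> i) $ i\<^sub>1 = centered w $ i" for w :: "real ^ 'n"
      by (simp add: centered_def)
    have "AE w in distr M borel W. centered w $ i\<^sub>1 \<in> {c\<^sub>1..c\<^sub>2}"
      using assms(3) by (subst AE_distr_iff) auto
    then have "AE w in distr M borel (\<lambda>\<omega>. \<chi> i. W \<omega> $ ?\<pi> i). centered w $ i\<^sub>1 \<in> {c\<^sub>1..c\<^sub>2}"
      using assms(2) perm unfolding exchangeable_def by metis
    then show ?thesis
      by (subst (asm) AE_distr_iff) (auto simp: swap)
  qed
  then show ?thesis by (simp add: AE_all_countable)
qed

section \<open>A one-sided confidence bound for an empirical mean\<close>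

lemma small_oscillation_interval:
  fixes S :: "real set"
  assumes "\<And>x y. x \<in> S \<Longrightarrow> y \<in> S \<Longrightarrow> x - y \<le> L"
  shows "S \<subseteq> {Inf S..Inf S + L}"
proof
  fix x assume "x \<in> S"
  then have low: "x - L \<le> y" if "y \<in> S" for y
    using assms[of x y] that by simp
  then have "bdd_below S" by (auto simp: bdd_below_def)
  moreover have "x - L \<le> Inf S"
    using low \<open>x \<in> S\<close> by (intro cInf_greatest) auto
  ultimately show "x \<in> {Inf S..Inf S + L}"
    using \<open>x \<in> S\<close> by (simp add: cInf_lower)
qed

text \<open>
  Hoeffding's inequality for the deviation \<open>\<epsilon> = B * L * t\<close> of the sum bounds the probability of
  failure by \<open>exp (- 2 * B * t\<^sup>2)\<close>, and \<open>t\<close> is chosen so that this equals \<open>\<beta>\<close>. The inequality requires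
  an interval of positive length; for \<open>L = 0\<close> the variables are almost surely constant and the
  bound holds almost surely.
\<close>

lemma (in prob_space) Hoeffding_mean_confidence:
  fixes X :: "nat \<Rightarrow> 'a \<Rightarrow> real" and \<beta> :: real
  assumes "B \<ge> 1" and "0 < \<beta>" and "\<beta> < 1"
    and indep: "indep_vars (\<lambda>_. borel) X {1..B}"
    and AE_in: "\<And>j. j \<in> {1..B} \<Longrightarrow> AE \<omega> in M. X j \<omega> \<in> {a..a + L}"
    and mean: "\<And>j. j \<in> {1..B} \<Longrightarrow> expectation (X j) = \<mu>"
  shows "prob {\<omega> \<in> space M. \<mu> \<le> (\<Sum>j=1..B. X j \<omega>) / real B
           + L * sqrt (ln (1 / \<beta>) / (2 * real B))} \<ge> 1 - \<beta>"
proof -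
  let ?t = "sqrt (ln (1 / \<beta>) / (2 * real B))"
  let ?S = "\<lambda>\<omega>. \<Sum>j=1..B. X j \<omega>"
  define good where "good = {\<omega> \<in> space M. \<mu> \<le> ?S \<omega> / real B + L * ?t}"
  interpret H: Hoeffding_ineq M "{1..B}" X "\<lambda>_. a" "\<lambda>_. a + L" "\<Sum>j=1..B. expectation (X j)"
    by unfold_locales (use indep AE_in in auto)
  have [measurable]: "X j \<in> borel_measurable M" if "j \<in> {1..B}" for j
    using H.random_variable that .
  have good_sets [measurable]: "good \<in> events" unfolding good_def by measurable
  have tsq: "?t\<^sup>2 = ln (1 / \<beta>) / (2 * real B)"
    using \<open>0 < \<beta>\<close> \<open>\<beta> < 1\<close> by simp
  have one: "1 \<in> {1..B}" using \<open>B \<ge> 1\<close> by simp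
  have "L \<ge> 0"
  proof (rule ccontr)
    assume "\<not> L \<ge> 0"
    then have "AE \<omega> in M. False" by (intro eventually_mono[OF AE_in[OF one]]) auto
    then show False by simp
  qed
  have "prob good \<ge> 1 - \<beta>"
  proof (cases "L = 0")
    case True
    have const: "AE \<omega> in M. X j \<omega> = a" if "j \<in> {1..B}" for j
      using AE_in[OF that] True by simp
    have "expectation (X 1) = expectation (\<lambda>_. a)"
      using const[OF one] one by (intro integral_cong_AE) auto
    then have "\<mu> = a" using mean[OF one] by (simp add: prob_space)
    have "AE \<omega> in M. \<forall>j\<in>{1..B}. X j \<omega> = a"
      using const by (intro AE_finite_allI) auto
    then have "AE \<omega> in M. \<omega> \<in> good"
      using AE_space
    proof eventually_elim
      case (elim \<omega>)
      then show ?case using \<open>B \<ge> 1\<close> \<open>\<mu> = a\<close> True by (simp add: good_def)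
    qed
    then have "prob good = 1" using prob_eq_1 by simp
    with \<open>0 < \<beta>\<close> show ?thesis by simp
  next
    case False
    with \<open>L \<ge> 0\<close> have "L > 0" by simp
    let ?\<epsilon> = "real B * (L * ?t)"
    have "prob (space M - good) \<le> prob {\<omega> \<in> space M. ?S \<omega> \<le> (\<Sum>j=1..B. expectation (X j)) - ?\<epsilon>}"
    proof (rule finite_measure_mono)
      show "space M - good \<subseteq> {\<omega> \<in> space M. ?S \<omega> \<le> (\<Sum>j=1..B. expectation (X j)) - ?\<epsilon>}"
        using \<open>B \<ge> 1\<close> mean by (auto simp: good_def field_simps)
    qed measurable
    also have "\<dots> \<le> exp (- 2 * ?\<epsilon>\<^sup>2 / (\<Sum>j=1..B. (a + L - a)\<^sup>2))"
      using \<open>L > 0\<close> \<open>B \<ge> 1\<close> \<open>0 < \<beta>\<close> \<open>\<beta> < 1\<close>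
      by (intro H.Hoeffding_ineq_le) auto
    also have "- 2 * ?\<epsilon>\<^sup>2 / (\<Sum>j=1..B. (a + L - a)\<^sup>2) = ln \<beta>"
      unfolding power_mult_distrib tsq using \<open>L > 0\<close> \<open>B \<ge> 1\<close> \<open>0 < \<beta>\<close>
      by (simp add: power2_eq_square ln_div)
    also have "exp (ln \<beta>) = \<beta>" using \<open>0 < \<beta>\<close> by simp
    finally show ?thesis using prob_compl[OF good_sets] by simp
  qed
  then show ?thesis by (simp add: good_def)
qed

theorem proposition2p7:
  fixes M :: "'a measure" and W :: "nat \<Rightarrow> 'a \<Rightarrow> real ^ 'n"
    and N :: "'b measure" and W' :: "'b \<Rightarrow> real ^ 'n"
    and i\<^sub>1 :: 'n and B :: nat and c\<^sub>1 c\<^sub>2 \<beta> :: real and p :: ennreal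
    and \<phi> :: "real ^ 'k \<Rightarrow> real" and Y :: "real ^ 'k ^ 'n" and m :: "real ^ 'k"
  assumes "CARD('n) \<ge> 2"
    and "B \<ge> 1"
    and "prob_space M"
    and "\<And>j. j \<in> {1..B} \<Longrightarrow> resampling_weight M (W j)"
    and "\<And>j. j \<in> {1..B} \<Longrightarrow> exchangeable M (W j)"
    and "prob_space.indep_vars M (\<lambda>_. borel) W {1..B}"
    and "\<And>j. j \<in> {1..B} \<Longrightarrow> distr M borel (W j) = distr M borel (W 1)"
    and "AE \<omega> in M. W 1 \<omega> $ i\<^sub>1 - vec_mean (W 1 \<omega>) \<in> {c\<^sub>1..c\<^sub>2}"
    and "prob_space N"
    and "W' \<in> borel_measurable N"
    and "distr N borel W' = distr M borel (W 1)"
    and "1 \<le> p"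
    and "\<And>x x'. \<phi> (x + x') \<le> \<phi> x + \<phi> x'"
    and "\<And>x. \<bar>\<phi> x\<bar> \<le> lp_norm p x"
    and "\<And>k. is_median (\<lambda>i. Y $ i $ k) (m $ k)"
    and "\<beta> \<in> {0<..<1}"
  shows "measure M {\<omega> \<in> space M.
           (\<integral>\<eta>. \<phi> (weighted_mean Y (centered (W' \<eta>))) \<partial>N)
             \<le> (\<Sum>j=1..B. \<phi> (weighted_mean Y (centered (W j \<omega>)))) / real B
                + (c\<^sub>2 - c\<^sub>1) * sqrt (ln (1 / \<beta>) / (2 * real B)) * lp_norm p (abs_deviation Y m)}
         \<ge> 1 - \<beta>"
proof -
  interpret prob_space M by fact
  note [measurable] = \<open>W' \<in> borel_measurable N\<close>
  have one: "1 \<in> {1..B}" using \<open>B \<ge> 1\<close> by simp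
  have W_meas [measurable]: "W j \<in> borel_measurable M" if "j \<in> {1..B}" for j
    using assms(4)[OF that] by (simp add: resampling_weight_def)
  define f where "f = (\<lambda>w. \<phi> (weighted_mean Y (centered w)))"
  define D where "D = {w :: real ^ 'n. \<forall>i. centered w $ i \<in> {c\<^sub>1..c\<^sub>2}}"
  define L where "L = (c\<^sub>2 - c\<^sub>1) * lp_norm p (abs_deviation Y m)"
  have "continuous_on UNIV f"
    unfolding f_def
    by (rule continuous_on_compose2[OF subadditive_continuous[OF assms(12,13,14)]
          continuous_weighted_mean_centered]) auto
  then have f_meas [measurable]: "f \<in> borel_measurable borel"
    by (rule borel_measurable_continuous_onI)
  have "f v - f w \<le> L" if "v \<in> D" "w \<in> D" for v w
    using functional_oscillation[OF assms(12,13,14), of v c\<^sub>1 c\<^sub>2 w Y m] that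
    by (simp add: f_def D_def L_def)
  then have range: "f ` D \<subseteq> {Inf (f ` D)..Inf (f ` D) + L}"
    by (intro small_oscillation_interval) auto
  have D_meas [measurable]: "D \<in> sets borel"
    unfolding D_def by (rule pred_Collect_borel) simp
  have "AE \<omega> in M. W 1 \<omega> \<in> D"
    unfolding D_def mem_Collect_eq
    using assms(5)[OF one] assms(8) W_meas[OF one]
    by (intro exchangeable_AE_centered) (auto simp: centered_def)
  then have "AE w in distr M borel (W 1). w \<in> D"
    by (subst AE_distr_iff) (use W_meas[OF one] D_meas in auto)
  then have D_AE: "AE w in distr M borel (W j). w \<in> D" if "j \<in> {1..B}" for j
    unfolding assms(7)[OF that] .
  have "AE \<omega> in M. W j \<omega> \<in> D" if "j \<in> {1..B}" for j
    using D_AE[OF that] by (subst (asm) AE_distr_iff) (use W_meas[OF that] D_meas in auto)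
  then have AE_in: "AE \<omega> in M. f (W j \<omega>) \<in> {Inf (f ` D)..Inf (f ` D) + L}"
    if "j \<in> {1..B}" for j
    using that range by fastforce
  have mean: "expectation (\<lambda>\<omega>. f (W j \<omega>)) = (\<integral>\<eta>. f (W' \<eta>) \<partial>N)" if "j \<in> {1..B}" for j
  proof -
    have "expectation (\<lambda>\<omega>. f (W j \<omega>)) = (\<integral>w. f w \<partial>distr M borel (W j))"
      using W_meas[OF that] by (simp add: integral_distr)
    also have "\<dots> = (\<integral>w. f w \<partial>distr N borel W')"
      using assms(7)[OF that] assms(11) by simp
    also have "\<dots> = (\<integral>\<eta>. f (W' \<eta>) \<partial>N)"
      by (simp add: integral_distr)
    finally show ?thesis .
  qed
  have indep: "indep_vars (\<lambda>_. borel) (\<lambda>j \<omega>. f (W j \<omega>)) {1..B}"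
    by (rule indep_vars_compose2[OF assms(6)]) simp
  from Hoeffding_mean_confidence[OF \<open>B \<ge> 1\<close> _ _ indep AE_in mean, of \<beta>] \<open>\<beta> \<in> {0<..<1}\<close>
  show ?thesis by (simp add: f_def L_def mult_ac)
qed

end
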